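(* Given $H$ and $R_s=\sum_{k=0}^s\alpha_k(\tau L)^k$ with $\alpha_0=1$, there exists a unique set of coefficients $\{\beta_k\}_{k=0}^s\cup\{\gamma_{i,j}\}_{i,j=0}^{s-1}$ such that for all $u$ and $L$ satisfying $L^\top H+HL\le 0$, $$\|R_su\|_H^2=\sum_{k=0}^s\beta_k\tau^{2k}\|L^ku\|_H^2+\sum_{i,j=0}^{s-1}\gamma_{i,j}\tau^{i+j+1}[L^iu,L^ju]_H,\qquad \gamma_{i,j}=\gamma_{j,i}.$$
   Context: $u\in\mathbb{R}^N$, $L$ is an $N\times N$ real constant matrix, and $H$ is an $N\times N$ symmetric positive definite matrix, where $N$ is the number of degrees of freedom of a spatial discretization. $R_s$ is the operator of an $s$-stage explicit Runge–Kutta method, $u^{n+1}=R_su^n$, applied to the linear autonomous system $\frac{d}{dt}u=Lu$. Its coefficients $\alpha_0,\dots,\alpha_s$ depend only on the scheme, and $\tau$ is the time step; the identity is understood to hold for all $\tau$, with the coefficients $\beta_k,\gamma_{i,j}$ independent of $\tau$, $u$ and $L$. $\langle\cdot,\cdot\rangle$ is the usual $l^2$ inner product on $\mathbb{R}^N$, $\langle v,w\rangle_H=\langle v,Hw\rangle$, and $\|v\|_H=\sqrt{\langle v,v\rangle_H}$. $L^\top H+HL\le 0$ means that this symmetric matrix is negative semi-definite. For such $L$, $[v,w]_H=-\langle v,(L^\top H+HL)w\rangle$ for $v,w\in\mathbb{R}^N$, which is a semi inner product depending on $L$.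
   Formalization: Uniqueness is asserted only for N ≥ 2 or s ≤ 1, since for N = 1 and s ≥ 2 the terms with β_1 and with γ_{0,1} = γ_{1,0} are proportional and uniqueness fails; existence is stated for all N and s. *)

theory Defs
  imports "HOL-Analysis.Analysis" "HOL-Library.FuncSet"
begin

definition symmetric_mat :: "real^'n^'n \<Rightarrow> bool" where
  "symmetric_mat A \<longleftrightarrow> transpose A = A"

definition pos_definite :: "real^'n^'n \<Rightarrow> bool" where
  "pos_definite A \<longleftrightarrow> symmetric_mat A \<and> (\<forall>x. x \<noteq> 0 \<longrightarrow> x \<bullet> (A *v x) > 0)"

definition neg_semidefinite :: "real^'n^'n \<Rightarrow> bool" where
  "neg_semidefinite A \<longleftrightarrow> symmetric_mat A \<and> (\<forall>x. x \<bullet> (A *v x) \<le> 0)"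

(* The overloaded power on real^'n^'n is entrywise, hence the separate matrix power. *)
primrec mat_power :: "real^'n^'n \<Rightarrow> nat \<Rightarrow> real^'n^'n" where
  "mat_power A 0 = mat 1"
| "mat_power A (Suc k) = A ** mat_power A k"

definition inner_H :: "real^'n^'n \<Rightarrow> real^'n \<Rightarrow> real^'n \<Rightarrow> real" where
  "inner_H H v w = v \<bullet> (H *v w)"

definition norm_H :: "real^'n^'n \<Rightarrow> real^'n \<Rightarrow> real" where
  "norm_H H v = sqrt (inner_H H v v)"

definition semi_inner_H :: "real^'n^'n \<Rightarrow> real^'n^'n \<Rightarrow> real^'n \<Rightarrow> real^'n \<Rightarrow> real" where
  "semi_inner_H H L v w = - (v \<bullet> ((transpose L ** H + H ** L) *v w))"

(* Every real sequence \<alpha> with \<alpha> 0 = 1 arises in this way from some s-stage explicit Runge-Kutta method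
   applied to u' = L u. *)
definition rk_operator :: "nat \<Rightarrow> (nat \<Rightarrow> real) \<Rightarrow> real \<Rightarrow> real^'n^'n \<Rightarrow> real^'n^'n" where
  "rk_operator s \<alpha> \<tau> L = (\<Sum>k\<le>s. \<alpha> k *\<^sub>R mat_power (\<tau> *\<^sub>R L) k)"

definition energy_identity ::
  "real^'n^'n \<Rightarrow> nat \<Rightarrow> (nat \<Rightarrow> real) \<Rightarrow> (nat \<Rightarrow> real) \<Rightarrow> (nat \<times> nat \<Rightarrow> real) \<Rightarrow>
   real \<Rightarrow> real^'n^'n \<Rightarrow> real^'n \<Rightarrow> bool" where
  "energy_identity H s \<alpha> \<beta> \<gamma> \<tau> L u \<longleftrightarrow>
     (norm_H H (rk_operator s \<alpha> \<tau> L *v u))\<^sup>2 =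
       (\<Sum>k\<le>s. \<beta> k * \<tau> ^ (2 * k) * (norm_H H (mat_power L k *v u))\<^sup>2) +
       (\<Sum>i<s. \<Sum>j<s. \<gamma> (i, j) * \<tau> ^ (i + j + 1) *
          semi_inner_H H L (mat_power L i *v u) (mat_power L j *v u))"

(* Coefficients are families indexed by {0..s} and {0..s-1} x {0..s-1}; extensionality fixes the
   values outside these index sets, so that equality of families means equality on them.
   In dimension 1 this set is not a singleton once s \<ge> 2: for L = (l), u = (x), H = (h), the terms
   of \<beta> 1 and of \<gamma> (0, 1) = \<gamma> (1, 0) are both multiples of (\<tau> l)^2 h x^2. Uniqueness can
   only be claimed in dimension at least 2 or for s \<le> 1. *)
definition energy_coeffs ::
  "real^'n^'n \<Rightarrow> nat \<Rightarrow> (nat \<Rightarrow> real) \<Rightarrow> ((nat \<Rightarrow> real) \<times> (nat \<times> nat \<Rightarrow> real)) set" where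
  "energy_coeffs H s \<alpha> =
     {(\<beta>, \<gamma>). \<beta> \<in> extensional {..s} \<and> \<gamma> \<in> extensional ({..<s} \<times> {..<s}) \<and>
        (\<forall>i<s. \<forall>j<s. \<gamma> (i, j) = \<gamma> (j, i)) \<and>
        (\<forall>L u \<tau>. neg_semidefinite (transpose L ** H + H ** L) \<longrightarrow>
           energy_identity H s \<alpha> \<beta> \<gamma> \<tau> L u)}"

end

theory Submission
  imports Defs
begin

text \<open>
  Since \<open>[v, w]\<^sub>H = - \<langle>L v, w\<rangle>\<^sub>H - \<langle>v, L w\<rangle>\<^sub>H\<close>, every Gram entry \<open>\<langle>L\<^sup>i u, L\<^sup>j u\<rangle>\<^sub>H\<close> can be
  moved to the diagonal at the cost of semi inner products, which gives existence. Conversely, the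
  right-hand side is a combination of Gram entries whose coefficients determine \<open>\<beta>\<close> and \<open>\<gamma>\<close> by a
  triangular recursion. To see that these coefficients are themselves determined, let \<open>L\<close> act on an
  \<open>H\<close>-orthonormal plane as multiplication by a complex number \<open>\<omega>\<close> with \<open>Re \<omega> \<le> 0\<close>: the Gram entries
  become \<open>Re (\<omega>\<^sup>i * cnj \<omega>\<^sup>j)\<close>, and the identity becomes polynomial in \<open>\<tau>\<close> and \<open>\<omega>\<close>. For \<open>s \<le> 1\<close> the
  single choice \<open>\<omega> = - 1\<close> suffices, and this needs only one dimension.
\<close>

section \<open>Bilinear algebra of the H inner product\<close>

lemma inner_H_add_left: "inner_H H (v + w) z = inner_H H v z + inner_H H w z"
  by (simp add: inner_H_def inner_add_left)

lemma inner_H_add_right: "inner_H H z (v + w) = inner_H H z v + inner_H H z w"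
  by (simp add: inner_H_def matrix_vector_right_distrib inner_add_right)

lemma inner_H_scaleR_left: "inner_H H (a *\<^sub>R v) z = a * inner_H H v z"
  by (simp add: inner_H_def)

lemma inner_H_scaleR_right: "inner_H H z (a *\<^sub>R v) = a * inner_H H z v"
  by (simp add: inner_H_def matrix_vector_mult_scaleR)

lemma inner_H_minus_left: "inner_H H (- v) z = - inner_H H v z"
  using inner_H_scaleR_left[of H "-1" v z] by simp

lemma inner_H_minus_right: "inner_H H z (- v) = - inner_H H z v"
  using inner_H_scaleR_right[of H z "-1" v] by simp

lemma inner_H_diff_left: "inner_H H (v - w) z = inner_H H v z - inner_H H w z"
  by (simp add: inner_H_def inner_diff_left)

lemma inner_H_diff_right: "inner_H H z (v - w) = inner_H H z v - inner_H H z w"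
  by (simp add: inner_H_def matrix_vector_mult_diff_distrib inner_diff_right)

lemmas inner_H_bilinear = inner_H_add_left inner_H_add_right inner_H_scaleR_left
  inner_H_scaleR_right inner_H_minus_left inner_H_minus_right inner_H_diff_left inner_H_diff_right

lemma inner_H_sum_left: "inner_H H (sum f A) z = (\<Sum>a\<in>A. inner_H H (f a) z)"
  by (simp add: inner_H_def inner_sum_left)

lemma inner_H_sum_right: "inner_H H z (sum f A) = (\<Sum>a\<in>A. inner_H H z (f a))"
proof (cases "finite A")
  case True
  then show ?thesis
    by (induction A rule: finite_induct) (simp_all add: inner_H_add_right, simp add: inner_H_def)
qed (simp add: inner_H_def)

text \<open>The adjoint relation, phrased for \<open>w v* A\<close>, which is
  \<open>transpose A *v w\<close>.\<close>

lemma inner_vector_matrix_mult: "v \<bullet> (w v* A) = (A *v v) \<bullet> (w::real^'m)"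
  by (metis dot_lmul_matrix inner_commute)

lemma inner_H_commute:
  assumes "symmetric_mat H"
  shows "inner_H H v w = inner_H H w v"
  using inner_vector_matrix_mult[of v w H] assms
  by (metis inner_H_def symmetric_mat_def inner_commute transpose_matrix_vector)

lemma norm_H_power2:
  assumes "pos_definite H"
  shows "(norm_H H v)\<^sup>2 = inner_H H v v"
proof -
  have "inner_H H v v \<ge> 0"
    using assms by (cases "v = 0") (auto simp: pos_definite_def inner_H_def less_imp_le)
  then show ?thesis by (simp add: norm_H_def)
qed

lemma semi_inner_H_eq:
  "semi_inner_H H L v w = - inner_H H (L *v v) w - inner_H H v (L *v w)"
  by (simp add: semi_inner_H_def inner_H_def matrix_vector_mult_add_rdistrib inner_add_right
      matrix_vector_mul_assoc[symmetric] inner_vector_matrix_mult)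

section \<open>Gram entries of the Krylov vectors and the Runge-Kutta energy\<close>

abbreviation gram :: "real^'n^'n \<Rightarrow> real^'n^'n \<Rightarrow> real^'n \<Rightarrow> nat \<Rightarrow> nat \<Rightarrow> real" where
  "gram H L u i j \<equiv> inner_H H (mat_power L i *v u) (mat_power L j *v u)"

lemma gram_commute: "symmetric_mat H \<Longrightarrow> gram H L u i j = gram H L u j i"
  by (rule inner_H_commute)

lemma semi_inner_H_mat_power:
  "semi_inner_H H L (mat_power L i *v u) (mat_power L j *v u) =
     - gram H L u (Suc i) j - gram H L u i (Suc j)"
  by (simp add: semi_inner_H_eq matrix_vector_mul_assoc)

lemma mat_power_scaleR: "mat_power (\<tau> *\<^sub>R L) k = \<tau> ^ k *\<^sub>R mat_power L k"
  by (induction k) (simp_all add: matrix_scalar_ac scalar_matrix_assoc[symmetric])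

lemma sum_matrix_vector_mult:
  fixes A :: "'a \<Rightarrow> real^'n^'m"
  shows "finite I \<Longrightarrow> (\<Sum>i\<in>I. A i) *v u = (\<Sum>i\<in>I. A i *v u)"
  by (induction I rule: finite_induct) (simp_all add: matrix_vector_mult_add_rdistrib)

lemma rk_operator_vector:
  "rk_operator s \<alpha> \<tau> L *v u = (\<Sum>k\<le>s. (\<alpha> k * \<tau> ^ k) *\<^sub>R (mat_power L k *v u))"
  by (simp add: rk_operator_def sum_matrix_vector_mult mat_power_scaleR
      scaleR_matrix_vector_assoc[symmetric])

lemma norm_H_rk_operator_power2:
  assumes "pos_definite H"
  shows "(norm_H H (rk_operator s \<alpha> \<tau> L *v u))\<^sup>2 =
    (\<Sum>i\<le>s. \<Sum>j\<le>s. \<alpha> i * \<alpha> j * (\<tau> ^ (i + j) * gram H L u i j))"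
  unfolding norm_H_power2[OF assms] rk_operator_vector inner_H_sum_left
  by (simp add: inner_H_sum_right inner_H_bilinear power_add sum_distrib_left ac_simps)

text \<open>Squared norms are written as inner products, so that the expression is visibly linear in
  the Gram entries.\<close>

definition energy_rhs ::
  "real^'n^'n \<Rightarrow> nat \<Rightarrow> (nat \<Rightarrow> real) \<Rightarrow> (nat \<times> nat \<Rightarrow> real) \<Rightarrow>
   real \<Rightarrow> real^'n^'n \<Rightarrow> real^'n \<Rightarrow> real" where
  "energy_rhs H s \<beta> \<gamma> \<tau> L u =
     (\<Sum>k\<le>s. \<beta> k * \<tau> ^ (2 * k) * gram H L u k k) +
     (\<Sum>i<s. \<Sum>j<s. \<gamma> (i, j) * \<tau> ^ (i + j + 1) *
        semi_inner_H H L (mat_power L i *v u) (mat_power L j *v u))"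

lemma energy_identity_iff:
  assumes "pos_definite H"
  shows "energy_identity H s \<alpha> \<beta> \<gamma> \<tau> L u \<longleftrightarrow>
    (norm_H H (rk_operator s \<alpha> \<tau> L *v u))\<^sup>2 = energy_rhs H s \<beta> \<gamma> \<tau> L u"
  by (simp add: energy_identity_def energy_rhs_def norm_H_power2[OF assms])

subsection \<open>Existence\<close>

text \<open>The coefficients are chosen before \<tau>, L and u, which encodes their independence of
  all three. Symmetry of \<gamma> is arranged afterwards by averaging.\<close>

definition representable ::
  "real^'n^'n \<Rightarrow> nat \<Rightarrow> (real \<Rightarrow> real^'n^'n \<Rightarrow> real^'n \<Rightarrow> real) \<Rightarrow> bool" where
  "representable H s F \<longleftrightarrow> (\<exists>\<beta> \<gamma>. \<forall>\<tau> L u. F \<tau> L u = energy_rhs H s \<beta> \<gamma> \<tau> L u)"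

lemma representable_zero: "representable H s (\<lambda>\<tau> L u. 0)"
  unfolding representable_def energy_rhs_def
  by (rule exI[of _ "\<lambda>_. 0"], rule exI[of _ "\<lambda>_. 0"]) simp

lemma representable_add:
  assumes "representable H s F" "representable H s G"
  shows "representable H s (\<lambda>\<tau> L u. F \<tau> L u + G \<tau> L u)"
proof -
  obtain \<beta> \<gamma> \<beta>' \<gamma>' where
    "\<And>\<tau> L u. F \<tau> L u = energy_rhs H s \<beta> \<gamma> \<tau> L u" "\<And>\<tau> L u. G \<tau> L u = energy_rhs H s \<beta>' \<gamma>' \<tau> L u"
    using assms unfolding representable_def by metis
  then show ?thesis
    unfolding representable_def energy_rhs_def
    by (intro exI[of _ "\<lambda>k. \<beta> k + \<beta>' k"] exI[of _ "\<lambda>p. \<gamma> p + \<gamma>' p"])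
      (simp add: distrib_right sum.distrib)
qed

lemma representable_scale:
  assumes "representable H s F"
  shows "representable H s (\<lambda>\<tau> L u. a * F \<tau> L u)"
proof -
  obtain \<beta> \<gamma> where "\<And>\<tau> L u. F \<tau> L u = energy_rhs H s \<beta> \<gamma> \<tau> L u"
    using assms unfolding representable_def by metis
  then show ?thesis
    unfolding representable_def energy_rhs_def
    by (intro exI[of _ "\<lambda>k. a * \<beta> k"] exI[of _ "\<lambda>p. a * \<gamma> p"])
      (simp add: distrib_left sum_distrib_left mult.assoc)
qed

lemma representable_sum:
  assumes "\<And>i. i \<in> I \<Longrightarrow> representable H s (F i)"
  shows "representable H s (\<lambda>\<tau> L u. \<Sum>i\<in>I. F i \<tau> L u)"
  using assms
  by (induction I rule: infinite_finite_induct)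
    (simp_all add: representable_zero representable_add)

lemma representable_diagonal:
  assumes "k \<le> s"
  shows "representable H s (\<lambda>\<tau> L u. \<tau> ^ (k + k) * gram H L u k k)"
  unfolding representable_def energy_rhs_def
  using assms
  by (intro exI[of _ "\<lambda>i. of_bool (i = k)"] exI[of _ "\<lambda>_. 0"])
    (simp add: of_bool_def if_distrib if_distribR mult_2 cong: if_cong)

lemma representable_semi_inner_H:
  assumes "i < s" "j < s"
  shows "representable H s (\<lambda>\<tau> L u. \<tau> ^ (i + j + 1) *
    semi_inner_H H L (mat_power L i *v u) (mat_power L j *v u))"
proof -
  have *: "(\<Sum>p<s. \<Sum>q<s. (if (p, q) = (i, j) then 1 else 0) * f p q) = (f i j :: real)" for f
  proof -
    have "(\<Sum>q<s. (if (p, q) = (i, j) then 1 else 0) * f p q) = (if p = i then f p j else 0)" for p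
      using assms by (cases "p = i") (simp_all add: if_distrib[of "\<lambda>x. x * _"] cong: if_cong)
    then show ?thesis
      using assms by (simp only: sum.delta finite_lessThan) simp
  qed
  show ?thesis
    unfolding representable_def energy_rhs_def
    by (intro exI[of _ "\<lambda>_. 0"] exI[of _ "\<lambda>p. if p = (i, j) then 1 else 0"])
      (simp only: mult.assoc * mult_zero_left sum.neutral_const add_0 simp_thms)
qed

text \<open>The two indices move towards each other until they meet at the diagonal or differ by one.\<close>
lemma representable_gram_le:
  assumes "symmetric_mat H" "i \<le> j" "j \<le> s"
  shows "representable H s (\<lambda>\<tau> L u. \<tau> ^ (i + j) * gram H L u i j)"
  using assms(2,3)
proof (induction "j - i" arbitrary: i j rule: less_induct)
  case less
  consider "i = j" | "j = Suc i" | k where "j = Suc k" "i < k"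
    using less.prems by (cases j) force+
  then show ?case
  proof cases
    case 1
    with less.prems show ?thesis by (simp add: representable_diagonal)
  next
    case 2
    \<comment> \<open>By symmetry the semi inner product of \<open>L^i u\<close> with itself is -2
      times the Gram entry at (i, i + 1), hence the factor -1/2.\<close>
    have "representable H s (\<lambda>\<tau> L u. (- 1 / 2) * (\<tau> ^ (i + i + 1) *
        semi_inner_H H L (mat_power L i *v u) (mat_power L i *v u)))"
      using 2 less.prems by (intro representable_scale representable_semi_inner_H) auto
    moreover have "gram H L u (Suc i) i = gram H L u i (Suc i)" for L u
      by (rule gram_commute[OF assms(1)])
    ultimately show ?thesis
      unfolding semi_inner_H_mat_power by (simp add: 2 field_simps)
  next
    case 3
    \<comment> \<open>Solving the expansion of the semi inner product at (i, k) for the entry at (i,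
      k + 1) leaves the entry at (i + 1, k), whose index gap is smaller by two.\<close>
    have "representable H s (\<lambda>\<tau> L u. (- 1) * (\<tau> ^ (i + k + 1) *
        semi_inner_H H L (mat_power L i *v u) (mat_power L k *v u)) +
        (- 1) * (\<tau> ^ (Suc i + k) * gram H L u (Suc i) k))"
      using 3 less.prems
      by (intro representable_add representable_scale representable_semi_inner_H less.hyps) auto
    then show ?thesis
      unfolding semi_inner_H_mat_power by (simp add: 3 algebra_simps)
  qed
qed

lemma representable_gram:
  assumes "symmetric_mat H" "i \<le> s" "j \<le> s"
  shows "representable H s (\<lambda>\<tau> L u. \<tau> ^ (i + j) * gram H L u i j)"
proof (cases "i \<le> j")
  case False
  then have "representable H s (\<lambda>\<tau> L u. \<tau> ^ (j + i) * gram H L u j i)"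
    using assms by (intro representable_gram_le) auto
  then show ?thesis
    by (simp add: gram_commute[OF assms(1), of _ i _ j] add.commute[of i j])
qed (use assms representable_gram_le in auto)

text \<open>The semi inner product is symmetric, so only the symmetric part of \<gamma> contributes
  to the double sum.\<close>

lemma energy_rhs_symmetrize:
  assumes "symmetric_mat H"
  shows "energy_rhs H s \<beta> (\<lambda>(i, j). (\<gamma> (i, j) + \<gamma> (j, i)) / 2) \<tau> L u = energy_rhs H s \<beta> \<gamma> \<tau> L u"
proof -
  define B where "B i j = \<tau> ^ (i + j + 1) * semi_inner_H H L (mat_power L i *v u) (mat_power L j *v u)"
    for i j
  have B: "B i j = B j i" for i j
    unfolding B_def semi_inner_H_mat_power
    using gram_commute[OF assms, of L "Suc i" u j] gram_commute[OF assms, of L i u "Suc j"]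
    by (simp add: add.commute)
  have "(\<Sum>i<s. \<Sum>j<s. \<gamma> (j, i) * B i j) = (\<Sum>i<s. \<Sum>j<s. \<gamma> (i, j) * B i j)"
    by (subst sum.swap) (simp add: B)
  then have "(\<Sum>i<s. \<Sum>j<s. (\<gamma> (i, j) + \<gamma> (j, i)) / 2 * B i j) = (\<Sum>i<s. \<Sum>j<s. \<gamma> (i, j) * B i j)"
    by (simp add: add_divide_distrib distrib_right sum.distrib sum_divide_distrib[symmetric])
  then show ?thesis
    by (simp add: energy_rhs_def B_def mult.assoc)
qed

lemma energy_rhs_cong:
  assumes "\<And>k. k \<le> s \<Longrightarrow> \<beta> k = \<beta>' k" "\<And>i j. i < s \<Longrightarrow> j < s \<Longrightarrow> \<gamma> (i, j) = \<gamma>' (i, j)"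
  shows "energy_rhs H s \<beta> \<gamma> \<tau> L u = energy_rhs H s \<beta>' \<gamma>' \<tau> L u"
  using assms by (simp add: energy_rhs_def)

lemma energy_coeffs_nonempty:
  assumes "pos_definite H"
  shows "\<exists>c. c \<in> energy_coeffs H s \<alpha>"
proof -
  have H: "symmetric_mat H"
    using assms by (simp add: pos_definite_def)
  have "representable H s (\<lambda>\<tau> L u. (norm_H H (rk_operator s \<alpha> \<tau> L *v u))\<^sup>2)"
    unfolding norm_H_rk_operator_power2[OF assms]
    by (intro representable_sum representable_scale representable_gram H) auto
  then obtain \<beta> \<gamma> where
    *: "\<And>\<tau> L u. (norm_H H (rk_operator s \<alpha> \<tau> L *v u))\<^sup>2 = energy_rhs H s \<beta> \<gamma> \<tau> L u"
    unfolding representable_def by metis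
  define \<gamma>' where "\<gamma>' = (\<lambda>(i, j). (\<gamma> (i, j) + \<gamma> (j, i)) / 2)"
  have "(restrict \<beta> {..s}, restrict \<gamma>' ({..<s} \<times> {..<s})) \<in> energy_coeffs H s \<alpha>"
  proof -
    have "energy_rhs H s (restrict \<beta> {..s}) (restrict \<gamma>' ({..<s} \<times> {..<s})) \<tau> L u =
        energy_rhs H s \<beta> \<gamma> \<tau> L u" for \<tau> L u
      unfolding energy_rhs_symmetrize[OF H, of s \<beta> \<gamma>, symmetric] \<gamma>'_def
      by (rule energy_rhs_cong) auto
    then show ?thesis
      by (auto simp: energy_coeffs_def energy_identity_iff[OF assms] * \<gamma>'_def add.commute)
  qed
  then show ?thesis by blast
qed

subsection \<open>Uniqueness\<close>

text \<open>The coefficient of \<open>\<tau> ^ (i + j) * gram H L u i j\<close> once the semi inner products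
  are expanded; the truncated subtractions are guarded.\<close>
definition gram_coeff :: "nat \<Rightarrow> (nat \<Rightarrow> real) \<Rightarrow> (nat \<times> nat \<Rightarrow> real) \<Rightarrow> nat \<Rightarrow> nat \<Rightarrow> real" where
  "gram_coeff s \<beta> \<gamma> i j = (if i = j then \<beta> i else 0)
     - (if 0 < i \<and> j < s then \<gamma> (i - 1, j) else 0) - (if 0 < j \<and> i < s then \<gamma> (i, j - 1) else 0)"

lemma sum_atMost_guarded_shift:
  fixes f :: "nat \<Rightarrow> 'a::comm_monoid_add"
  shows "(\<Sum>i\<le>s. if 0 < i then f i else 0) = (\<Sum>i<s. f (Suc i))"
  by (simp add: lessThan_Suc_atMost[symmetric] sum.lessThan_Suc_shift del: sum.lessThan_Suc)

lemma sum_atMost_guarded_less: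
  fixes f :: "nat \<Rightarrow> 'a::comm_monoid_add"
  shows "(\<Sum>i\<le>s. if i < s then f i else 0) = (\<Sum>i<s. f i)"
  by (simp add: lessThan_Suc_atMost[symmetric])

text \<open>Each \<gamma>(i, j) enters with sign -1 at (i + 1, j) and at (i, j + 1). Shifting the
  index in these two sums makes everything range over the full square.\<close>

lemma energy_rhs_gram_coeff:
  "energy_rhs H s \<beta> \<gamma> \<tau> L u =
    (\<Sum>i\<le>s. \<Sum>j\<le>s. gram_coeff s \<beta> \<gamma> i j * (\<tau> ^ (i + j) * gram H L u i j))"
proof -
  define A where "A i j = \<tau> ^ (i + j) * gram H L u i j" for i j
  have 1: "(\<Sum>i\<le>s. \<Sum>j\<le>s. (if i = j then \<beta> i else 0) * A i j) = (\<Sum>k\<le>s. \<beta> k * A k k)"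
    by (intro sum.cong refl) (simp add: if_distrib[of "\<lambda>x. x * _"] cong: if_cong)
  have 2: "(\<Sum>i\<le>s. \<Sum>j\<le>s. (if 0 < i \<and> j < s then \<gamma> (i - 1, j) else 0) * A i j) =
      (\<Sum>i<s. \<Sum>j<s. \<gamma> (i, j) * A (Suc i) j)"
  proof -
    have "(\<Sum>i\<le>s. \<Sum>j\<le>s. (if 0 < i \<and> j < s then \<gamma> (i - 1, j) else 0) * A i j) =
      (\<Sum>i\<le>s. if 0 < i then \<Sum>j\<le>s. if j < s then \<gamma> (i - 1, j) * A i j else 0 else 0)"
      by (auto intro!: sum.cong)
    then show ?thesis
      by (simp only: sum_atMost_guarded_shift sum_atMost_guarded_less) simp
  qed
  have 3: "(\<Sum>i\<le>s. \<Sum>j\<le>s. (if 0 < j \<and> i < s then \<gamma> (i, j - 1) else 0) * A i j) =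
      (\<Sum>i<s. \<Sum>j<s. \<gamma> (i, j) * A i (Suc j))"
  proof -
    have "(\<Sum>i\<le>s. \<Sum>j\<le>s. (if 0 < j \<and> i < s then \<gamma> (i, j - 1) else 0) * A i j) =
      (\<Sum>i\<le>s. if i < s then \<Sum>j\<le>s. if 0 < j then \<gamma> (i, j - 1) * A i j else 0 else 0)"
      by (auto intro!: sum.cong)
    then show ?thesis
      by (simp only: sum_atMost_guarded_shift sum_atMost_guarded_less) simp
  qed
  have "energy_rhs H s \<beta> \<gamma> \<tau> L u = (\<Sum>k\<le>s. \<beta> k * A k k)
      - (\<Sum>i<s. \<Sum>j<s. \<gamma> (i, j) * A (Suc i) j) - (\<Sum>i<s. \<Sum>j<s. \<gamma> (i, j) * A i (Suc j))"
    unfolding energy_rhs_def semi_inner_H_mat_power A_def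
    by (simp add: mult_2_right algebra_simps sum.distrib sum_subtractf sum_negf)
  also have "\<dots> = (\<Sum>i\<le>s. \<Sum>j\<le>s. gram_coeff s \<beta> \<gamma> i j * A i j)"
    unfolding 1[symmetric] 2[symmetric] 3[symmetric] gram_coeff_def
    by (simp only: left_diff_distrib sum_subtractf)
  finally show ?thesis by (simp only: A_def)
qed

lemma gram_coeff_commute:
  assumes "\<And>i j. i < s \<Longrightarrow> j < s \<Longrightarrow> \<gamma> (i, j) = \<gamma> (j, i)" "i \<le> s" "j \<le> s"
  shows "gram_coeff s \<beta> \<gamma> i j = gram_coeff s \<beta> \<gamma> j i"
  using assms(1)[of "i - 1" j] assms(1)[of i "j - 1"] assms(2,3)
  by (auto simp: gram_coeff_def)

text \<open>Row 0 of the Gram coefficients yields row 0 of \<gamma>. On and above the diagonal, each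
  further row of \<gamma> follows from the previous one, and symmetry supplies the rest. The
  diagonal coefficients then yield \<beta>.\<close>

lemma gram_coeff_inject:
  assumes sym: "\<And>i j. i < s \<Longrightarrow> j < s \<Longrightarrow> \<gamma> (i, j) = \<gamma> (j, i)"
      "\<And>i j. i < s \<Longrightarrow> j < s \<Longrightarrow> \<gamma>' (i, j) = \<gamma>' (j, i)"
    and eq: "\<And>i j. i \<le> s \<Longrightarrow> j \<le> s \<Longrightarrow> gram_coeff s \<beta> \<gamma> i j = gram_coeff s \<beta>' \<gamma>' i j"
  shows "\<And>i j. i < s \<Longrightarrow> j < s \<Longrightarrow> \<gamma> (i, j) = \<gamma>' (i, j)" and "\<And>k. k \<le> s \<Longrightarrow> \<beta> k = \<beta>' k"
proof -
  have le: "\<gamma> (i, j) = \<gamma>' (i, j)" if "i \<le> j" "j < s" for i j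
    using that
  proof (induction i arbitrary: j)
    case 0
    then show ?case using eq[of 0 "Suc j"] by (simp add: gram_coeff_def)
  next
    case (Suc i)
    \<comment> \<open>Since \<open>Suc i \<le> j\<close>, the entry at (\<open>Suc i\<close>,
      \<open>Suc j\<close>) is off the diagonal and free of \<beta>. The previous row is used at
      column \<open>Suc j\<close>; if \<open>Suc j = s\<close>, the guard removes that term.\<close>
    from Suc.prems Suc.IH[of "Suc j"] eq[of "Suc i" "Suc j"] show ?case
      by (simp add: gram_coeff_def split: if_splits)
  qed
  show g: "\<gamma> (i, j) = \<gamma>' (i, j)" if "i < s" "j < s" for i j
    using le[of i j] le[of j i] sym[of i j] that by (cases "i \<le> j") auto
  show "\<beta> k = \<beta>' k" if "k \<le> s" for k
    using eq[of k k] g[of "k - 1" k] g[of k "k - 1"] that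
    by (simp add: gram_coeff_def split: if_splits)
qed

section \<open>Vanishing of coefficients by polynomial identities\<close>

text \<open>Grouping by total degree gives a polynomial in \<tau> that vanishes everywhere, so each
  of its coefficients is zero.\<close>

lemma homogeneous_components_eq_0:
  fixes b :: "nat \<Rightarrow> nat \<Rightarrow> real"
  assumes "\<And>\<tau>. (\<Sum>i\<le>s. \<Sum>j\<le>s. b i j * \<tau> ^ (i + j)) = 0" "m \<le> 2 * s"
  shows "(\<Sum>i\<le>s. \<Sum>j\<le>s. if i + j = m then b i j else 0) = 0"
proof -
  define a where "a m = (\<Sum>i\<le>s. \<Sum>j\<le>s. if i + j = m then b i j else 0)" for m
  have "(\<Sum>m\<le>2 * s. a m * \<tau> ^ m) = 0" for \<tau>
  proof -
    have "(\<Sum>m\<le>2 * s. a m * \<tau> ^ m) =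
        (\<Sum>m\<le>2 * s. \<Sum>i\<le>s. \<Sum>j\<le>s. if i + j = m then b i j * \<tau> ^ m else 0)"
      unfolding a_def sum_distrib_right by (intro sum.cong refl) auto
    also have "\<dots> = (\<Sum>i\<le>s. \<Sum>m\<le>2 * s. \<Sum>j\<le>s. if i + j = m then b i j * \<tau> ^ m else 0)"
      by (rule sum.swap)
    also have "\<dots> = (\<Sum>i\<le>s. \<Sum>j\<le>s. \<Sum>m\<le>2 * s. if i + j = m then b i j * \<tau> ^ m else 0)"
      by (rule sum.cong[OF refl]) (rule sum.swap)
    also have "\<dots> = (\<Sum>i\<le>s. \<Sum>j\<le>s. b i j * \<tau> ^ (i + j))"
      by (intro sum.cong refl) simp
    finally show ?thesis
      by (simp add: assms(1))
  qed
  then have "\<forall>m\<le>2 * s. a m = 0"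
    using polyfun_eq_0[where c = a and n = "2 * s"] by simp
  with assms(2) show ?thesis by (simp add: a_def)
qed

text \<open>\<open>cis\<close> is injective on [0, 1] because the cosine is injective on [0, pi].
  Infinitely many points force a polynomial vanishing on the circle to be zero.\<close>

lemma infinite_unit_circle: "infinite {z. cmod z = 1}"
proof
  assume "finite {z. cmod z = 1}"
  moreover have "cis ` {0..1} \<subseteq> {z. cmod z = 1}" by auto
  ultimately have "finite (cis ` {0..1})" by (rule rev_finite_subset)
  moreover have "inj_on cis {0..1}"
  proof (rule inj_onI)
    fix x y :: real
    assume "x \<in> {0..1}" "y \<in> {0..1}" "cis x = cis y"
    then show "x = y"
      using cos_inj_pi[of x y] pi_gt3 by (auto simp: complex_eq_iff)
  qed
  ultimately have "finite {0..1::real}" by (rule finite_imageD)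
  then show False
    using infinite_Icc[of 0 "1::real"] by simp
qed

text \<open>Symmetry makes the sum over \<open>i + j = m\<close> of \<open>c i j * (\<omega> ^ i * cnj \<omega> ^ j)\<close> real.
  On the unit circle, multiplying it by \<open>\<omega> ^ m\<close> turns it into a polynomial in \<open>\<omega>\<^sup>2\<close>,
  and \<open>\<omega>\<^sup>2\<close> covers the whole circle even if \<open>Re \<omega> \<le> 0\<close>.\<close>
lemma symmetric_coeffs_eq_0:
  fixes c :: "nat \<Rightarrow> nat \<Rightarrow> real"
  assumes sym: "\<And>i j. i \<le> s \<Longrightarrow> j \<le> s \<Longrightarrow> c i j = c j i"
    and zero: "\<And>\<omega> m. Re \<omega> \<le> 0 \<Longrightarrow> m \<le> 2 * s \<Longrightarrow>
      (\<Sum>i\<le>s. \<Sum>j\<le>s. if i + j = m then c i j * Re (\<omega> ^ i * cnj \<omega> ^ j) else 0) = 0"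
    and ij: "i \<le> s" "j \<le> s"
  shows "c i j = 0"
proof -
  define m where "m = i + j"
  have m: "m \<le> 2 * s" using ij by (simp add: m_def)
  \<comment> \<open>At most one q contributes to \<open>e p\<close>, namely q = m - p. As m = i + j,
    the value at i is exactly \<open>c i j\<close>.\<close>
  define e :: "nat \<Rightarrow> complex" where "e p = of_real (\<Sum>q\<le>s. if p + q = m then c p q else 0)" for p
  have "(\<Sum>p\<le>s. e p * z ^ p) = 0" if "cmod z = 1" for z
  proof -
    \<comment> \<open>The principal root has nonnegative real part, so its negative is the
      admissible square root of z.\<close>
    define \<omega> where "\<omega> = - csqrt z"
    have \<omega>: "Re \<omega> \<le> 0" "\<omega>\<^sup>2 = z"
      using Re_csqrt[of z] by (simp_all add: \<omega>_def)
    have unit: "\<omega> * cnj \<omega> = 1"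
      using that by (simp add: complex_norm_square[symmetric] \<omega>_def norm_csqrt)
    define T where "T p q = (if p + q = m then of_real (c p q) * (\<omega> ^ p * cnj \<omega> ^ q) else 0)" for p q
    have "cnj (T p q) = T q p" if "p \<le> s" "q \<le> s" for p q
      using that sym by (simp add: T_def add.commute mult.commute)
    then have "cnj (\<Sum>p\<le>s. \<Sum>q\<le>s. T p q) = (\<Sum>p\<le>s. \<Sum>q\<le>s. T q p)"
      by simp
    also have "\<dots> = (\<Sum>p\<le>s. \<Sum>q\<le>s. T p q)"
      by (rule sum.swap)
    finally have "Im (\<Sum>p\<le>s. \<Sum>q\<le>s. T p q) = 0"
      by (metis Reals_cnj_iff complex_is_Real_iff)
    moreover have "Re (\<Sum>p\<le>s. \<Sum>q\<le>s. T p q) = 0"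
    proof -
      have "Re (T p q) = (if p + q = m then c p q * Re (\<omega> ^ p * cnj \<omega> ^ q) else 0)" for p q
        by (simp add: T_def)
      then show ?thesis
        using zero[OF \<omega>(1) m] by simp
    qed
    ultimately have "0 = \<omega> ^ m * (\<Sum>p\<le>s. \<Sum>q\<le>s. T p q)"
      by (simp add: complex_eq_iff)
    also have "\<dots> = (\<Sum>p\<le>s. e p * z ^ p)"
      unfolding sum_distrib_left e_def of_real_sum sum_distrib_right
    proof (intro sum.cong refl)
      fix p q
      have "\<omega> ^ (p + q) * (\<omega> ^ p * cnj \<omega> ^ q) = z ^ p * (\<omega> * cnj \<omega>) ^ q"
        by (simp add: \<omega>(2)[symmetric] power_add power_mult_distrib power2_eq_square mult_ac)
      then show "\<omega> ^ m * T p q = of_real (if p + q = m then c p q else 0) * z ^ p"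
        by (auto simp: T_def unit)
    qed
    finally show ?thesis by simp
  qed
  then have "{z. cmod z = 1} \<subseteq> {z. (\<Sum>p\<le>s. e p * z ^ p) = 0}" by auto
  then have "infinite {z. (\<Sum>p\<le>s. e p * z ^ p) = 0}"
    using infinite_unit_circle infinite_super by blast
  then have "e i = 0"
    using polyfun_finite_roots[of e s] ij by blast
  moreover have "e i = of_real (c i j)"
    using ij by (simp add: e_def m_def)
  ultimately show ?thesis by simp
qed

section \<open>Complex multiplication realized on an H-orthonormal plane\<close>

lemma pos_definite_normalize:
  assumes "pos_definite H" "v \<noteq> 0"
  shows "\<exists>a. inner_H H (a *\<^sub>R v) (a *\<^sub>R v) = 1"
proof -
  have "inner_H H v v > 0"
    using assms by (simp add: pos_definite_def inner_H_def)
  then show ?thesis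
    by (intro exI[of _ "1 / sqrt (inner_H H v v)"]) (simp add: inner_H_bilinear field_simps)
qed

lemma H_unit_vector:
  fixes H :: "real^'n^'n"
  assumes "pos_definite H"
  obtains e where "inner_H H e e = 1"
proof -
  have "(axis undefined 1 :: real^'n) \<noteq> 0" by simp
  from pos_definite_normalize[OF assms this] that show ?thesis by blast
qed

lemma H_orthonormal_pair:
  fixes H :: "real^'n^'n"
  assumes "pos_definite H" "CARD('n) \<ge> 2"
  obtains e f where "inner_H H e e = 1" "inner_H H f f = 1" "inner_H H e f = 0"
proof -
  obtain i j :: 'n where ij: "i \<noteq> j"
    using assms(2) card_le_Suc0_iff_eq[of "UNIV :: 'n set"] by auto
  obtain a where a: "inner_H H (a *\<^sub>R axis i 1) (a *\<^sub>R axis i 1) = 1"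
    using pos_definite_normalize[OF assms(1), of "axis i 1"] by auto
  define e :: "real^'n" where "e = a *\<^sub>R axis i 1"
  \<comment> \<open>One Gram-Schmidt step. As e is a multiple of the i-th axis vector, component j
    of g stays 1, so g is nonzero.\<close>
  define g :: "real^'n" where "g = axis j 1 - inner_H H e (axis j 1) *\<^sub>R e"
  have "g $ j = 1"
    using ij by (simp add: g_def e_def axis_def)
  then have "g \<noteq> 0" by auto
  then obtain b where b: "inner_H H (b *\<^sub>R g) (b *\<^sub>R g) = 1"
    using pos_definite_normalize[OF assms(1)] by blast
  have "inner_H H e (b *\<^sub>R g) = 0"
    using a by (simp add: inner_H_bilinear g_def e_def[symmetric])
  with a b that show ?thesis by (simp add: e_def)
qed

text \<open>For \<open>H\<close>-orthonormal \<open>e\<close>, \<open>f\<close>, this is the sum of \<open>Re \<omega>\<close> times the identity and an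
  \<open>H\<close>-skew map; it acts on the plane spanned by \<open>e\<close>, \<open>f\<close> as multiplication by \<open>\<omega>\<close>.\<close>
definition plane_mult :: "real^'n^'n \<Rightarrow> real^'n \<Rightarrow> real^'n \<Rightarrow> complex \<Rightarrow> real^'n^'n" where
  "plane_mult H e f \<omega> = matrix (\<lambda>v. Re \<omega> *\<^sub>R v +
     Im \<omega> *\<^sub>R (inner_H H e v *\<^sub>R f - inner_H H f v *\<^sub>R e))"

lemma plane_mult_vector:
  "plane_mult H e f \<omega> *v v = Re \<omega> *\<^sub>R v + Im \<omega> *\<^sub>R (inner_H H e v *\<^sub>R f - inner_H H f v *\<^sub>R e)"
  unfolding plane_mult_def
  by (subst matrix_works) (auto intro!: linearI simp: linear_matrix_vector_mul_eq inner_H_bilinear algebra_simps)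

text \<open>The H-skew part cancels in the quadratic form, leaving \<open>2 * Re \<omega>\<close>
  times the squared H norm.\<close>

lemma plane_mult_dissipative:
  fixes H :: "real^'n^'n"
  assumes "pos_definite H" "Re \<omega> \<le> 0"
  shows "neg_semidefinite (transpose (plane_mult H e f \<omega>) ** H + H ** plane_mult H e f \<omega>)"
proof -
  let ?L = "plane_mult H e f \<omega>"
  have H: "symmetric_mat H"
    using assms by (simp add: pos_definite_def)
  have "transpose (A + B) = transpose A + transpose B" for A B :: "real^'n^'n"
    by (simp add: transpose_def vec_eq_iff)
  then have "symmetric_mat (transpose ?L ** H + H ** ?L)"
    using H by (simp add: symmetric_mat_def matrix_transpose_mul add.commute)
  moreover have "v \<bullet> ((transpose ?L ** H + H ** ?L) *v v) \<le> 0" for v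
  proof -
    have "v \<bullet> ((transpose ?L ** H + H ** ?L) *v v) = inner_H H (?L *v v) v + inner_H H v (?L *v v)"
      using semi_inner_H_eq[of H ?L v v] by (simp add: semi_inner_H_def)
    also have "\<dots> = 2 * (Re \<omega> * inner_H H v v)"
      by (simp add: plane_mult_vector inner_H_bilinear inner_H_commute[OF H, of v e]
          inner_H_commute[OF H, of v f] algebra_simps)
    also have "\<dots> \<le> 0"
      using assms(2) norm_H_power2[OF assms(1), of v] zero_le_power2[of "norm_H H v"]
      by (simp add: mult_nonpos_nonneg)
    finally show ?thesis .
  qed
  ultimately show ?thesis
    by (simp add: neg_semidefinite_def)
qed

text \<open>With e and f in the roles of 1 and the imaginary unit, \<open>L^k e\<close> has the
  coordinates of \<open>\<omega> ^ k\<close>, and the H inner product becomes the real inner product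
  of complex numbers. The alternative \<open>Im \<omega> = 0\<close> admits f = 0, hence dimension
  one.\<close>

lemma gram_plane_mult:
  assumes "symmetric_mat H" "inner_H H e e = 1" "inner_H H e f = 0"
    and f: "inner_H H f f = 1 \<or> Im \<omega> = 0"
  shows "gram H (plane_mult H e f \<omega>) e i j = Re (\<omega> ^ i * cnj \<omega> ^ j)"
proof -
  have fe: "inner_H H f e = 0"
    using assms by (metis inner_H_commute)
  have power: "mat_power (plane_mult H e f \<omega>) k *v e = Re (\<omega> ^ k) *\<^sub>R e + Im (\<omega> ^ k) *\<^sub>R f" for k
  proof (induction k)
    case (Suc k)
    have "Im (\<omega> ^ k) * inner_H H f f * Im \<omega> = Im (\<omega> ^ k) * Im \<omega>"
      using f by auto
    then have "(Im (\<omega> ^ k) * inner_H H f f * Im \<omega>) *\<^sub>R e = (Im (\<omega> ^ k) * Im \<omega>) *\<^sub>R e"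
      by (rule arg_cong)
    then show ?case
      by (simp add: matrix_vector_mul_assoc[symmetric] Suc plane_mult_vector inner_H_bilinear
          assms fe algebra_simps)
  qed simp
  have "Im (\<omega> ^ i) * inner_H H f f * Im (\<omega> ^ j) = Im (\<omega> ^ i) * Im (\<omega> ^ j)"
    using f by (metis Reals_power complex_is_Real_iff mult.right_neutral mult_zero_left)
  then show ?thesis
    by (simp add: power inner_H_bilinear assms(2,3) fe mult_ac flip: complex_cnj_power)
qed

section \<open>Uniqueness of the coefficient families\<close>

lemma energy_coeffs_unique:
  fixes H :: "real^'n^'n"
  assumes H: "pos_definite H" and dim: "CARD('n) \<ge> 2 \<or> s \<le> 1"
    and x: "x \<in> energy_coeffs H s \<alpha>" and y: "y \<in> energy_coeffs H s \<alpha>"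
  shows "x = y"
proof -
  obtain \<beta> \<gamma> \<beta>' \<gamma>' where xy: "x = (\<beta>, \<gamma>)" "y = (\<beta>', \<gamma>')"
    by (metis surj_pair)
  have sym: "\<And>i j. i < s \<Longrightarrow> j < s \<Longrightarrow> \<gamma> (i, j) = \<gamma> (j, i)"
      "\<And>i j. i < s \<Longrightarrow> j < s \<Longrightarrow> \<gamma>' (i, j) = \<gamma>' (j, i)"
    using x y by (auto simp: energy_coeffs_def xy)
  \<comment> \<open>Two solutions agree once the difference of their Gram coefficients
    vanishes.\<close>
  define c where "c i j = gram_coeff s \<beta> \<gamma> i j - gram_coeff s \<beta>' \<gamma>' i j" for i j
  have c_sym: "c i j = c j i" if "i \<le> s" "j \<le> s" for i j
    using gram_coeff_commute[of s \<gamma> i j \<beta>] gram_coeff_commute[of s \<gamma>' i j \<beta>'] sym that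
    by (simp add: c_def)
  have c_gram: "(\<Sum>i\<le>s. \<Sum>j\<le>s. c i j * (\<tau> ^ (i + j) * gram H L u i j)) = 0"
    if "neg_semidefinite (transpose L ** H + H ** L)" for \<tau> L u
  proof -
    have "energy_rhs H s \<beta> \<gamma> \<tau> L u = energy_rhs H s \<beta>' \<gamma>' \<tau> L u"
      using x y that by (auto simp: energy_coeffs_def xy energy_identity_iff[OF H])
    then show ?thesis
      by (simp add: c_def energy_rhs_gram_coeff left_diff_distrib sum_subtractf)
  qed
  have c_plane: "(\<Sum>i\<le>s. \<Sum>j\<le>s. if i + j = m then c i j * Re (\<omega> ^ i * cnj \<omega> ^ j) else 0) = 0"
    if "inner_H H e e = 1" "inner_H H e f = 0" "inner_H H f f = 1 \<or> Im \<omega> = 0" "Re \<omega> \<le> 0" "m \<le> 2 * s"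
    for e f \<omega> m
  proof (rule homogeneous_components_eq_0[OF _ that(5)])
    have "symmetric_mat H"
      using H by (simp add: pos_definite_def)
    note gram_plane_mult[OF this that(1-3)]
    with c_gram[OF plane_mult_dissipative[OF H that(4), of e f], of _ e]
    show "(\<Sum>i\<le>s. \<Sum>j\<le>s. c i j * Re (\<omega> ^ i * cnj \<omega> ^ j) * \<tau> ^ (i + j)) = 0" for \<tau>
      by (simp only: mult_ac)
  qed
  have "c i j = 0" if ij: "i \<le> s" "j \<le> s" for i j
  proof (cases "CARD('n) \<ge> 2")
    case True
    then obtain e f where "inner_H H e e = 1" "inner_H H f f = 1" "inner_H H e f = 0"
      using H_orthonormal_pair[OF H] by blast
    then show ?thesis
      using symmetric_coeffs_eq_0[of s c i j] c_sym c_plane ij by blast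
  next
    case False
    with dim have s: "s \<le> 1" by simp
    obtain e where "inner_H H e e = 1"
      using H_unit_vector[OF H] .
    \<comment> \<open>With f = 0 and \<omega> = -1 the test matrix is minus the identity.\<close>
    then have *: "(\<Sum>i\<le>s. \<Sum>j\<le>s. if i + j = m then c i j * Re ((- 1) ^ i * cnj (- 1) ^ j) else 0) = 0"
      if "m \<le> 2 * s" for m
      using c_plane[of e 0 "- 1" m] that by (simp add: inner_H_def)
    consider "s = 0" | "s = 1" using s by linarith
    then show ?thesis
    proof cases
      case 1
      with *[of 0] ij show ?thesis by simp
    next
      case 2
      have "c 0 1 = c 1 0" using c_sym 2 by simp
      moreover have "i = 0 \<or> i = 1" "j = 0 \<or> j = 1" using ij 2 by auto
      \<comment> \<open>Degrees 0 and 2 isolate \<open>c 0 0\<close> and \<open>c 1 1\<close>;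
        degree 1 gives \<open>c 0 1 + c 1 0 = 0\<close>, which symmetry splits. For larger s, degree
        2 would mix \<open>c 1 1\<close> with \<open>c 0 2\<close> and \<open>c 2 0\<close>.\<close>
      ultimately show ?thesis
        using *[of 0] *[of 1] *[of 2] by (auto simp: 2)
    qed
  qed
  then have "gram_coeff s \<beta> \<gamma> i j = gram_coeff s \<beta>' \<gamma>' i j" if "i \<le> s" "j \<le> s" for i j
    using that by (simp add: c_def)
  note eqs = gram_coeff_inject[OF sym this]
  have "\<beta> = \<beta>'"
    by (rule extensionalityI[of _ "{..s}"]) (use x y eqs(2) in \<open>auto simp: energy_coeffs_def xy\<close>)
  moreover have "\<gamma> = \<gamma>'"
    by (rule extensionalityI[of _ "{..<s} \<times> {..<s}"])
      (use x y eqs(1) in \<open>auto simp: energy_coeffs_def xy\<close>)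
  ultimately show ?thesis by (simp add: xy)
qed

theorem lemma2p3:
  fixes H :: "real^'n^'n" and s :: nat and \<alpha> :: "nat \<Rightarrow> real"
  assumes "pos_definite H" and "\<alpha> 0 = 1"
  shows "(\<exists>c. c \<in> energy_coeffs H s \<alpha>) \<and>
         (CARD('n) \<ge> 2 \<or> s \<le> 1 \<longrightarrow> (\<exists>!c. c \<in> energy_coeffs H s \<alpha>))"
  using energy_coeffs_nonempty[OF assms(1)] energy_coeffs_unique[OF assms(1)] by blast

end
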